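(* Let $\Gamma=\langle M;R\rangle$ be a graph and let $P\subseteq M$ be a nonempty property. Then the following conditions are equivalent: (1) $P$ is totally preserved under the formula $R(x,y)\vee R(y,x)$; (2) $P$ is totally preserved under the formula $\psi_n(x,y)\vee\psi_n(y,x)$ with some/any $n\geq 1$ (that is, the version of this condition with "for some $n\ge 1$" and the version with "for every $n\ge 1$" are both equivalent to (1) and (3)); (3) $P$ is a union of connected components of $\Gamma$.
   Context: A graph $\Gamma=\langle M;R\rangle$ is a set $M$ with a binary relation $R$ (possibly directed). For $n\in\omega$, $\varphi_n(x,y)$ is the formula saying that there exists an $(x,y)$-path of length $n$ along $R$, and $\psi_n(x,y):=\bigvee_{m\leq n}\varphi_m(x,y)$ says that there exists an $(x,y)$-path of length $\leq n$. A set $P$ is totally preserved under a formula $\theta(x,y)$ if for every $a\in P$, $\theta(a,\Gamma)=\{b\in M\mid\Gamma\models\theta(a,b)\}\subseteq P$. Connected components are those of the graph obtained by forgetting directions, i.e. with edge relation $R(x,y)\vee R(y,x)$. *)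

theory Defs
  imports "Graph_Theory.Graph_Theory"
begin

text \<open>A graph with universe M and edge relation R is a \<open>pair_pre_digraph\<close> with vertex set M and
  arc set R, subject to \<open>pair_wf_digraph\<close> (that is, R is a relation on M); it may be directed,
  infinite and have loops. A formula in two free variables is given by its truth value at each
  pair of elements of each graph.\<close>

type_synonym 'a formula2 = "'a pair_pre_digraph \<Rightarrow> 'a \<Rightarrow> 'a \<Rightarrow> bool"

definition edge_formula :: "'a formula2" where
  "edge_formula \<Gamma> x y \<longleftrightarrow> (x, y) \<in> parcs \<Gamma>"

text \<open>Paths may repeat vertices, and the path of length 0 joins a vertex to itself. Forbidding
  repetitions would not change \<open>psi_formula\<close>, as a shortest walk repeats no vertex.\<close>

definition phi_formula :: "nat \<Rightarrow> 'a formula2" where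
  "phi_formula n \<Gamma> x y \<longleftrightarrow> (\<exists>p. pre_digraph.awalk (with_proj \<Gamma>) x p y \<and> length p = n)"

definition psi_formula :: "nat \<Rightarrow> 'a formula2" where
  "psi_formula n \<Gamma> x y \<longleftrightarrow> (\<exists>m\<le>n. phi_formula m \<Gamma> x y)"

definition sym_formula :: "'a formula2 \<Rightarrow> 'a formula2" where
  "sym_formula \<theta> \<Gamma> x y \<longleftrightarrow> \<theta> \<Gamma> x y \<or> \<theta> \<Gamma> y x"

definition solution_set :: "'a pair_pre_digraph \<Rightarrow> 'a formula2 \<Rightarrow> 'a \<Rightarrow> 'a set" where
  "solution_set \<Gamma> \<theta> a = {b \<in> pverts \<Gamma>. \<theta> \<Gamma> a b}"

definition totally_preserved :: "'a pair_pre_digraph \<Rightarrow> 'a set \<Rightarrow> 'a formula2 \<Rightarrow> bool" where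
  "totally_preserved \<Gamma> P \<theta> \<longleftrightarrow> (\<forall>a\<in>P. solution_set \<Gamma> \<theta> a \<subseteq> P)"

text \<open>Components as vertex sets: once directions are forgotten, the strongly connected
  components are the connected components.\<close>

definition connected_components :: "'a pair_pre_digraph \<Rightarrow> 'a set set" where
  "connected_components \<Gamma> = verts ` pre_digraph.sccs (with_proj (mk_symmetric (with_proj \<Gamma>)))"

end

theory Submission
  imports Defs
begin

text \<open>Preservation under the symmetrized edge formula says that no edge joins P to its
  complement. Membership in P is then constant along walks (\<open>awalk_endpoints_in_iff\<close>).
  In \<Gamma> itself this yields preservation under every symmetrized \<open>psi_formula n\<close>;
  as single edges are walks of length 1, each n \<ge> 1 gives a condition equivalent to the one on
  edges, so "some" and "every" agree (\<open>totally_preserved_sym_psi_iff\<close>). In the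
  symmetrized graph it shows that P contains the component of each of its vertices
  (\<open>totally_preserved_sym_edge_iff_Union_components\<close>).\<close>

lemma totally_preserved_sym_edge_iff:
  "totally_preserved \<Gamma> P (sym_formula edge_formula) \<longleftrightarrow>
    (\<forall>a\<in>P. \<forall>b\<in>pverts \<Gamma>. (a, b) \<in> parcs \<Gamma> \<or> (b, a) \<in> parcs \<Gamma> \<longrightarrow> b \<in> P)"
  by (auto simp: totally_preserved_def solution_set_def sym_formula_def edge_formula_def)

context pair_wf_digraph
begin

text \<open>Each arc has both ends in P or both outside it, so membership propagates along the walk.
  The equivalence serves both disjuncts of a symmetrized formula: walks leaving a point of P and
  walks arriving at one.\<close>

lemma awalk_endpoints_in_iff:
  assumes "totally_preserved G P (sym_formula edge_formula)" "awalk u p v"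
  shows "u \<in> P \<longleftrightarrow> v \<in> P"
  using assms(2)
proof (induction p arbitrary: u)
  case (Cons e p)
  then have "(u, snd e) \<in> parcs G" "snd e \<in> P \<longleftrightarrow> v \<in> P"
    by (auto simp: awalk_Cons_iff)
  then show ?case
    using assms(1) wellformed' unfolding totally_preserved_sym_edge_iff by blast
qed (simp add: awalk_Nil_iff)

lemma totally_preserved_sym_psi_iff:
  assumes "n \<ge> 1"
  shows "totally_preserved G P (sym_formula (psi_formula n)) \<longleftrightarrow>
    totally_preserved G P (sym_formula edge_formula)"
proof
  have "psi_formula n G u v" if "edge_formula G u v" for u v
  proof -
    have "awalk u [(u, v)] v"
      using that by (auto simp: edge_formula_def awalk_simps intro: wellformed')
    \<comment> \<open>The edge is a walk of length 1, within the bound because n \<ge> 1.\<close>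
    then show ?thesis
      using assms by (auto simp: psi_formula_def phi_formula_def intro!: exI[of _ 1])
  qed
  then show "totally_preserved G P (sym_formula edge_formula)"
    if "totally_preserved G P (sym_formula (psi_formula n))"
    using that by (auto simp: totally_preserved_def solution_set_def sym_formula_def)
next
  assume "totally_preserved G P (sym_formula edge_formula)"
  then show "totally_preserved G P (sym_formula (psi_formula n))"
    using awalk_endpoints_in_iff
    unfolding totally_preserved_def[of _ _ "sym_formula (psi_formula n)"] solution_set_def
      sym_formula_def psi_formula_def phi_formula_def by blast
qed

text \<open>Indexing components by their vertices turns a union of components into a union of sets
  \<open>scc_of u\<close>, which are described by mutual reachability.\<close>

lemma connected_components_eq_scc_of:
  "connected_components G = pre_digraph.scc_of (mk_symmetric G) ` pverts G"
proof -
  interpret S: pair_wf_digraph "mk_symmetric G" ..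
  show ?thesis
    by (simp add: connected_components_def S.sccs_verts_conv[symmetric] S.sccs_verts_conv_scc_of)
qed

lemma totally_preserved_sym_edge_iff_Union_components:
  assumes "P \<subseteq> pverts G"
  shows "totally_preserved G P (sym_formula edge_formula) \<longleftrightarrow>
    (\<exists>\<C>. \<C> \<subseteq> connected_components G \<and> P = \<Union> \<C>)"
proof -
  interpret S: pair_wf_digraph "mk_symmetric G" ..
  have parcs_S: "(a, b) \<in> parcs (mk_symmetric G) \<longleftrightarrow> (a, b) \<in> parcs G \<or> (b, a) \<in> parcs G" for a b
    by (simp add: parcs_mk_symmetric Bex_def) blast
  show ?thesis
  proof
    assume "totally_preserved G P (sym_formula edge_formula)"
    \<comment> \<open>The formula already ignores directions, so symmetrizing the graph does not
      change the condition; walk invariance thus becomes available in the symmetrized graph.\<close>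
    then have P: "totally_preserved (mk_symmetric G) P (sym_formula edge_formula)"
      by (simp only: totally_preserved_sym_edge_iff parcs_S pverts_mk_symmetric with_proj_simps
          disj_commute disj_absorb)
    have "S.scc_of u \<subseteq> P" if "u \<in> P" for u
    proof
      fix v assume "v \<in> S.scc_of u"
      then have "u \<rightarrow>\<^sup>*\<^bsub>mk_symmetric G\<^esub> v"
        by (simp add: S.scc_of_def)
      then obtain p where "S.awalk u p v"
        unfolding S.reachable_awalk ..
      with that show "v \<in> P"
        by (simp add: S.awalk_endpoints_in_iff[OF P])
    qed
    \<comment> \<open>P consists of vertices, and each vertex reaches itself, so the components of
      the points of P cover P.\<close>
    moreover have "u \<in> S.scc_of u" if "u \<in> P" for u
      using assms that by (intro S.in_scc_of_self) (simp add: subset_iff)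
    ultimately have "P = \<Union> (S.scc_of ` P)"
      by blast
    then show "\<exists>\<C>. \<C> \<subseteq> connected_components G \<and> P = \<Union> \<C>"
      unfolding connected_components_eq_scc_of using image_mono[OF assms] by (intro exI conjI)
  next
    assume "\<exists>\<C>. \<C> \<subseteq> connected_components G \<and> P = \<Union> \<C>"
    then obtain V where P: "P = \<Union> (S.scc_of ` V)"
      unfolding connected_components_eq_scc_of by (auto simp: subset_image_iff)
    show "totally_preserved G P (sym_formula edge_formula)"
      unfolding totally_preserved_sym_edge_iff
    proof (intro ballI impI)
      fix a b assume "a \<in> P" and ab: "(a, b) \<in> parcs G \<or> (b, a) \<in> parcs G"
      then obtain u where u: "u \<in> V" "a \<in> S.scc_of u"
        unfolding P by blast
      \<comment> \<open>Strong connectedness asks for reachability both ways: one arc extends the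
        path from u to a, the other the path from a back to u.\<close>
      have arcs: "(a, b) \<in> parcs (mk_symmetric G)" "(b, a) \<in> parcs (mk_symmetric G)"
        using ab by (simp_all only: parcs_S disj_commute)
      have "u \<rightarrow>\<^sup>*\<^bsub>mk_symmetric G\<^esub> a" "a \<rightarrow>\<^sup>*\<^bsub>mk_symmetric G\<^esub> u"
        using u(2) by (simp_all add: S.scc_of_def)
      then have "b \<in> S.scc_of u"
        using S.reachable_adj_trans[OF _ arcs(1)] S.adj_reachable_trans[OF arcs(2)]
        by (simp add: S.scc_of_def)
      then show "b \<in> P"
        unfolding P using u(1) by blast
    qed
  qed
qed

end

theorem theorem8p2:
  fixes \<Gamma> :: "'a pair_pre_digraph" and P :: "'a set"
  assumes "pair_wf_digraph \<Gamma>"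
    and "P \<subseteq> pverts \<Gamma>" and "P \<noteq> {}"
  shows "(totally_preserved \<Gamma> P (sym_formula edge_formula)
            \<longleftrightarrow> (\<exists>n\<ge>1. totally_preserved \<Gamma> P (sym_formula (psi_formula n))))
       \<and> ((\<exists>n\<ge>1. totally_preserved \<Gamma> P (sym_formula (psi_formula n)))
            \<longleftrightarrow> (\<forall>n\<ge>1. totally_preserved \<Gamma> P (sym_formula (psi_formula n))))
       \<and> ((\<forall>n\<ge>1. totally_preserved \<Gamma> P (sym_formula (psi_formula n)))
            \<longleftrightarrow> (\<exists>\<C>. \<C> \<subseteq> connected_components \<Gamma> \<and> P = \<Union> \<C>))"
proof -
  interpret pair_wf_digraph \<Gamma> by fact
  show ?thesis
    using totally_preserved_sym_psi_iff totally_preserved_sym_edge_iff_Union_components[OF assms(2)]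
    by auto
qed

end
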